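(* Let $N=2^t$ with $t\ge 1$, and let $\mathbf A_{N,\alpha}=[\alpha^{kl}]_{k=1,l=0}^{N,N-1}$ be the delay Vandermonde matrix defined by the distinct complex nodes $\alpha,\alpha^2,\dots,\alpha^N$. Then $$\mathbf A_{N,\alpha}=\mathbf P_N^T\begin{bmatrix}\mathbf A_{\frac N2,\alpha^2}&0\\0&\mathbf A_{\frac N2,\alpha^2}\end{bmatrix}\begin{bmatrix}\bar{\mathbf D}_{\frac N2}&0\\0&\bar{\mathbf D}_{\frac N2}\end{bmatrix}\begin{bmatrix}\mathbf I_{\frac N2}&\mathbf C_{\frac N2}^{\frac N2}\\ \tilde{\mathbf D}_{\frac N2}&\alpha^{\frac N2}\,\mathbf C_{\frac N2}^{\frac N2}\,\tilde{\mathbf D}_{\frac N2}\end{bmatrix}\mathbf D_N,$$ where $\mathbf A_{\frac N2,\alpha^2}=[\alpha^{2kl}]_{k=1,l=0}^{\frac N2,\frac N2-1}$, $\bar{\mathbf D}_{\frac N2}=\operatorname{diag}\left[\frac1{\alpha^{2k}}\right]_{k=0}^{\frac N2-1}$, $\tilde{\mathbf D}_{\frac N2}=\operatorname{diag}[\alpha^l]_{l=0}^{\frac N2-1}$, $\mathbf D_N=\operatorname{diag}[\alpha^k]_{k=0}^{N-1}$, $\mathbf P_N$ is the even-odd permutation matrix, $\mathbf I_{\frac N2}$ is the identity matrix, and $\mathbf C_{\frac N2}$ is the companion matrix of the monic polynomial $p(z)=(z-1)(z-\alpha^2)(z-\alpha^4)\cdots(z-\alpha^{N-2})$.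
   Context: The even-odd permutation matrix $\mathbf P_N$ is the $N\times N$ permutation matrix with $\mathbf P_N(x_0,x_1,\dots,x_{N-1})^T=(x_0,x_2,\dots,x_{N-2},x_1,x_3,\dots,x_{N-1})^T$. The companion matrix of a monic polynomial $p(z)=z^n+\sum_{i=0}^{n-1}w_iz^i$ is the $n\times n$ matrix with ones on the first subdiagonal, last column $(-w_0,-w_1,\dots,-w_{n-1})^T$, and zeros elsewhere (for $n=1$ it is $[-w_0]$). *)

theory Defs
  imports
    "Jordan_Normal_Form.Matrix"
    "HOL-Computational_Algebra.Polynomial"
    Complex_Main
begin

(* The node index k runs from 1 to N, whereas matrix rows are numbered from 0:
   row i belongs to the node \<alpha> ^ (i + 1). *)
definition delay_vandermonde :: "nat \<Rightarrow> complex \<Rightarrow> complex mat" where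
  "delay_vandermonde N \<alpha> = mat N N (\<lambda>(i, l). \<alpha> ^ ((i + 1) * l))"

(* Meant for even N only; even_odd_perm_mat_mult_vec is the characterising property. *)
definition even_odd_perm_mat :: "nat \<Rightarrow> complex mat" where
  "even_odd_perm_mat N =
     mat N N (\<lambda>(i, j). if j = (if i < N div 2 then 2 * i else 2 * (i - N div 2) + 1)
                        then 1 else 0)"

lemma even_odd_perm_mat_mult_vec:
  assumes "even N"
  shows "even_odd_perm_mat N *\<^sub>v vec N x =
    vec N (\<lambda>i. if i < N div 2 then x (2 * i) else x (2 * (i - N div 2) + 1))"
proof (rule eq_vecI)
  fix i
  assume "i < dim_vec (vec N (\<lambda>i. if i < N div 2 then x (2 * i) else x (2 * (i - N div 2) + 1)))"
  then have i: "i < N" by simp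
  define c where "c = (if i < N div 2 then 2 * i else 2 * (i - N div 2) + 1)"
  have c: "c < N" using i assms unfolding c_def by (auto elim!: evenE)
  have "(even_odd_perm_mat N *\<^sub>v vec N x) $ i = (\<Sum>j = 0..<N. (if j = c then 1 else 0) * x j)"
    using i by (simp add: even_odd_perm_mat_def scalar_prod_def c_def)
  also have "\<dots> = (\<Sum>j = 0..<N. if j = c then x j else 0)"
    by (rule sum.cong) auto
  also have "\<dots> = x c" using c by simp
  finally show "(even_odd_perm_mat N *\<^sub>v vec N x) $ i =
    vec N (\<lambda>i. if i < N div 2 then x (2 * i) else x (2 * (i - N div 2) + 1)) $ i"
    using i by (simp add: c_def)
qed (simp add: even_odd_perm_mat_def)

(* Meant for monic p only: the leading coefficient is not used. The last column takes
   precedence over the subdiagonal, so degree 1 gives the 1 x 1 matrix with entry - coeff p 0. *)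
definition companion_mat :: "complex poly \<Rightarrow> complex mat" where
  "companion_mat p =
     mat (degree p) (degree p)
       (\<lambda>(i, j). if j = degree p - 1 then - coeff p i else if i = j + 1 then 1 else 0)"

definition even_node_poly :: "nat \<Rightarrow> complex \<Rightarrow> complex poly" where
  "even_node_poly n \<alpha> = (\<Prod>k<n. [:- (\<alpha> ^ (2 * k)), 1:])"

definition block_diag2 :: "complex mat \<Rightarrow> complex mat" where
  "block_diag2 A = four_block_mat A (0\<^sub>m (dim_row A) (dim_col A)) (0\<^sub>m (dim_row A) (dim_col A)) A"

end

theory Submission
  imports Defs
begin

text \<open>Every row \<open>(1, x, \<dots>, x\<^sup>n\<^sup>-\<^sup>1)\<close> with \<open>p x = 0\<close> is a left eigenvector, with
  eigenvalue \<open>x\<close>, of the companion matrix \<open>C\<close> of \<open>p\<close>. So multiplying the Vandermonde matrix \<open>V\<close>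
  in the nodes \<open>1, \<alpha>\<^sup>2, \<dots>, \<alpha>\<^sup>N\<^sup>-\<^sup>2\<close> by \<open>C ^ n\<close> with \<open>n = N / 2\<close> shifts its exponents by \<open>n\<close>,
  and \<open>V\<close> together with \<open>V C ^ n\<close> lists the powers from \<open>0\<close> to \<open>N - 1\<close> of these nodes.
  The diagonal factors turn the nodes into the odd powers of \<open>\<alpha>\<close> (upper half) and its even
  powers (lower half), and the permutation interleaves the two halves.\<close>

lemma degree_even_node_poly [simp]: "degree (even_node_poly n \<alpha>) = n"
  unfolding even_node_poly_def by (subst degree_prod_sum_eq) auto

lemma lead_coeff_even_node_poly: "lead_coeff (even_node_poly n \<alpha>) = 1"
  unfolding even_node_poly_def by (subst lead_coeff_prod) auto

lemma poly_even_node_poly_node: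
  assumes "k < n"
  shows "poly (even_node_poly n \<alpha>) (\<alpha> ^ (2 * k)) = 0"
  using assms by (auto simp: even_node_poly_def poly_prod)

lemma companion_mat_carrier [simp]: "companion_mat p \<in> carrier_mat (degree p) (degree p)"
  by (simp add: companion_mat_def)

lemma monic_root_power_degree:
  fixes p :: "'a :: comm_ring_1 poly"
  assumes "lead_coeff p = 1" and "poly p x = 0"
  shows "x ^ degree p = - (\<Sum>j<degree p. coeff p j * x ^ j)"
proof -
  have "poly p x = (\<Sum>j<degree p. coeff p j * x ^ j) + x ^ degree p"
    using assms(1) by (simp add: poly_altdef lessThan_Suc_atMost[symmetric])
  with assms(2) show ?thesis by (simp add: eq_neg_iff_add_eq_0 add.commute)
qed

text \<open>In every column but the last, the subdiagonal one picks out the next power of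
  \<open>x i\<close>. The last column combines the powers below \<open>degree p\<close> into
  \<open>x i ^ degree p\<close>, by \<open>monic_root_power_degree\<close>. The offset
  \<open>k\<close> allows the step to be iterated.\<close>

lemma vandermonde_mult_companion:
  assumes "lead_coeff p = 1" and "\<And>i. i < m \<Longrightarrow> poly p (x i) = 0"
  shows "mat m (degree p) (\<lambda>(i, l). x i ^ (k + l)) * companion_mat p
    = mat m (degree p) (\<lambda>(i, l). x i ^ (Suc k + l))" (is "?V * _ = ?W")
proof (rule eq_matI)
  fix i l assume "i < dim_row ?W" and "l < dim_col ?W"
  then have i: "i < m" and l: "l < degree p" by auto
  have "(?V * companion_mat p) $$ (i, l)
    = (\<Sum>j<degree p. x i ^ (k + j) *
        (if l = degree p - 1 then - coeff p j else if j = l + 1 then 1 else 0))"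
    using i l by (simp add: companion_mat_def scalar_prod_def lessThan_atLeast0)
  also have "\<dots> = x i ^ (Suc k + l)"
  proof (cases "l = degree p - 1")
    \<comment> \<open>Here \<open>l < degree p\<close> makes the degree positive, so
      \<open>Suc k + l = k + degree p\<close>.\<close>
    case True
    have "(\<Sum>j<degree p. x i ^ (k + j) * - coeff p j)
      = x i ^ k * - (\<Sum>j<degree p. coeff p j * x i ^ j)"
      by (simp add: power_add sum_distrib_left sum_negf mult_ac)
    also have "\<dots> = x i ^ k * x i ^ degree p"
      using monic_root_power_degree[OF assms(1) assms(2)[OF i]] by simp
    finally show ?thesis using True l by (simp flip: power_add power_Suc)
  next
    case False
    then have "(\<Sum>j<degree p. x i ^ (k + j) *
        (if l = degree p - 1 then - coeff p j else if j = l + 1 then 1 else 0))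
      = (\<Sum>j<degree p. if j = l + 1 then x i ^ (k + j) else 0)"
      by (intro sum.cong) auto
    with False l show ?thesis by simp
  qed
  finally show "(?V * companion_mat p) $$ (i, l) = ?W $$ (i, l)"
    using i l by simp
qed (auto simp: companion_mat_def)

lemma vandermonde_mult_companion_power:
  assumes "lead_coeff p = 1" and "\<And>i. i < m \<Longrightarrow> poly p (x i) = 0"
  shows "mat m (degree p) (\<lambda>(i, l). x i ^ l) * companion_mat p ^\<^sub>m k
    = mat m (degree p) (\<lambda>(i, l). x i ^ (k + l))"
proof (induction k)
  case 0
  show ?case by (simp add: companion_mat_def)
next
  case (Suc k)
  let ?V = "mat m (degree p) (\<lambda>(i, l). x i ^ l)"
  have "?V * companion_mat p ^\<^sub>m Suc k = ?V * companion_mat p ^\<^sub>m k * companion_mat p"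
    by (simp add: assoc_mult_mat[of _ m "degree p" _ "degree p" _ "degree p"])
  also have "\<dots> = mat m (degree p) (\<lambda>(i, l). x i ^ (Suc k + l))"
    unfolding Suc.IH by (rule vandermonde_mult_companion[where x = x, OF assms])
  finally show ?case .
qed

text \<open>Column \<open>i\<close> of the permutation matrix has its only one in row
  \<open>c\<close>, the place to which the even-odd sorting sends index \<open>i\<close>. As
  \<open>N\<close> is even, both halves have \<open>N div 2\<close> indices and the sorting is
  inverted exactly.\<close>

lemma transpose_even_odd_perm_mat_mult:
  assumes "even N" and "A \<in> carrier_mat N m"
  shows "transpose_mat (even_odd_perm_mat N) * A
    = mat N m (\<lambda>(i, j). A $$ (if even i then i div 2 else N div 2 + i div 2, j))"
    (is "_ = ?B")
proof (rule eq_matI)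
  fix i j assume "i < dim_row ?B" and "j < dim_col ?B"
  then have i: "i < N" and j: "j < m" by auto
  define c where "c = (if even i then i div 2 else N div 2 + i div 2)"
  have c: "c < N"
    using i assms(1) unfolding c_def by (auto elim!: evenE oddE)
  have iff: "i = (if k < N div 2 then 2 * k else 2 * (k - N div 2) + 1) \<longleftrightarrow> k = c"
    if "k < N" for k
    using that i assms(1) unfolding c_def by (auto elim!: evenE oddE) presburger+
  have "(transpose_mat (even_odd_perm_mat N) * A) $$ (i, j)
    = (\<Sum>k<N. (if i = (if k < N div 2 then 2 * k else 2 * (k - N div 2) + 1) then 1 else 0)
        * A $$ (k, j))"
    using i j assms(2) by (simp add: even_odd_perm_mat_def scalar_prod_def lessThan_atLeast0)
  also have "\<dots> = (\<Sum>k<N. if k = c then A $$ (k, j) else 0)"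
    using iff by (intro sum.cong) auto
  also have "\<dots> = A $$ (c, j)"
    using c by simp
  finally show "(transpose_mat (even_odd_perm_mat N) * A) $$ (i, j) = ?B $$ (i, j)"
    using i j by (simp add: c_def)
qed (use assms in \<open>auto simp: even_odd_perm_mat_def\<close>)

lemma block_diag2_mult_four_block_mat:
  assumes "A \<in> carrier_mat m n"
    and "B1 \<in> carrier_mat n p" "B2 \<in> carrier_mat n q" "B3 \<in> carrier_mat n p" "B4 \<in> carrier_mat n q"
  shows "block_diag2 A * four_block_mat B1 B2 B3 B4
    = four_block_mat (A * B1) (A * B2) (A * B3) (A * B4)"
  using assms unfolding block_diag2_def
  by (subst mult_four_block_mat[where ?nr1.0 = m and ?n1.0 = n and ?n2.0 = n and ?nr2.0 = m
        and ?nc1.0 = p and ?nc2.0 = q]) auto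

lemma block_diag2_mult:
  assumes "A \<in> carrier_mat m n" and "B \<in> carrier_mat n p"
  shows "block_diag2 A * block_diag2 B = block_diag2 (A * B)"
  using block_diag2_mult_four_block_mat[of A m n B p "0\<^sub>m n p" p "0\<^sub>m n p" B] assms
  by (simp add: block_diag2_def)

theorem corollary3p2:
  fixes \<alpha> :: complex and t N :: nat
  assumes "t \<ge> 1" and "N = 2 ^ t"
    and "inj_on (\<lambda>k. \<alpha> ^ k) {1..N}"
  shows "delay_vandermonde N \<alpha> =
    transpose_mat (even_odd_perm_mat N)
    * block_diag2 (delay_vandermonde (N div 2) (\<alpha>\<^sup>2))
    * block_diag2 (mat_diag (N div 2) (\<lambda>k. 1 / \<alpha> ^ (2 * k)))
    * four_block_mat
        (1\<^sub>m (N div 2))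
        (companion_mat (even_node_poly (N div 2) \<alpha>) ^\<^sub>m (N div 2))
        (mat_diag (N div 2) (\<lambda>l. \<alpha> ^ l))
        (\<alpha> ^ (N div 2) \<cdot>\<^sub>m
          (companion_mat (even_node_poly (N div 2) \<alpha>) ^\<^sub>m (N div 2)
           * mat_diag (N div 2) (\<lambda>l. \<alpha> ^ l)))
    * mat_diag N (\<lambda>k. \<alpha> ^ k)"
proof -
  define n where "n = N div 2"
  have N: "N = 2 * n"
    using assms(1,2) unfolding n_def by (cases t) auto
  have "n > 0"
    using N assms(2) by (cases n) auto
  \<comment> \<open>For \<alpha> = 0 the first two nodes would coincide, and both occur because N is
    at least 2. The inverse powers in \<open>D'\<close> rely on this.\<close>
  have "\<alpha> \<noteq> 0"
  proof
    assume "\<alpha> = 0"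
    then have "\<alpha> ^ 1 = \<alpha> ^ 2" by simp
    then have "(1::nat) = 2"
      using N \<open>n > 0\<close> by (intro inj_onD[OF assms(3)]) auto
    then show False by simp
  qed
  define V where "V = mat n n (\<lambda>(i, l). (\<alpha> ^ (2 * i)) ^ l)"
  define C where "C = companion_mat (even_node_poly n \<alpha>) ^\<^sub>m n"
  define E where "E = mat_diag n (\<lambda>l. \<alpha> ^ l)"
  define P where "P = transpose_mat (even_odd_perm_mat N)"
  define A where "A = delay_vandermonde n (\<alpha>\<^sup>2)"
  define D' where "D' = mat_diag n (\<lambda>k. 1 / \<alpha> ^ (2 * k))"
  define F where "F = four_block_mat (1\<^sub>m n) C E (\<alpha> ^ n \<cdot>\<^sub>m (C * E))"
  define D where "D = mat_diag N (\<lambda>k. \<alpha> ^ k)"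
  have V [simp]: "V \<in> carrier_mat n n" by (simp add: V_def)
  have C [simp]: "C \<in> carrier_mat n n"
    unfolding C_def using companion_mat_carrier[of "even_node_poly n \<alpha>"] by simp
  have E [simp]: "E \<in> carrier_mat n n" by (simp add: E_def)
  have CE [simp]: "C * E \<in> carrier_mat n n" by (rule mult_carrier_mat[OF C E])
  have P [simp]: "P \<in> carrier_mat N N" by (simp add: P_def even_odd_perm_mat_def)
  have A [simp]: "A \<in> carrier_mat n n" by (simp add: A_def delay_vandermonde_def)
  have D' [simp]: "D' \<in> carrier_mat n n" by (simp add: D'_def)
  have F [simp]: "F \<in> carrier_mat N N"
    unfolding F_def N mult_2 by (intro four_block_carrier_mat) auto
  have D [simp]: "D \<in> carrier_mat N N" by (simp add: D_def)
  have block_diag2_carrier [simp]: "block_diag2 M \<in> carrier_mat N N" if "M \<in> carrier_mat n n" for M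
    using that unfolding block_diag2_def N mult_2 by (intro four_block_carrier_mat) auto

  \<comment> \<open>Row \<open>i\<close> of \<open>A\<close> has the node
    \<open>\<alpha> ^ (2 * (i + 1))\<close>; dividing column \<open>l\<close> by
    \<open>\<alpha> ^ (2 * l)\<close> lowers it to \<open>\<alpha> ^ (2 * i)\<close>, a root of
    \<open>even_node_poly n \<alpha>\<close>.\<close>
  have AD': "A * D' = V"
    unfolding D'_def
    by (subst mat_diag_mult_right[OF A])
      (use \<open>\<alpha> \<noteq> 0\<close> in \<open>auto simp: A_def V_def delay_vandermonde_def algebra_simps
        power_add simp flip: power_mult\<close>)
  have VC: "V * C = mat n n (\<lambda>(i, l). (\<alpha> ^ (2 * i)) ^ (n + l))"
    unfolding V_def C_def
    using vandermonde_mult_companion_power[OF lead_coeff_even_node_poly,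
        of n n \<alpha> "\<lambda>i. \<alpha> ^ (2 * i)" n] poly_even_node_poly_node
    by simp
  have VE: "V * E = mat n n (\<lambda>(i, l). (\<alpha> ^ (2 * i)) ^ l * \<alpha> ^ l)"
    unfolding E_def by (subst mat_diag_mult_right[OF V]) (auto simp: V_def)
  \<comment> \<open>\<open>E\<close> gives column \<open>l\<close> only the factor
    \<open>\<alpha> ^ l\<close>; the scalar \<open>\<alpha> ^ n\<close> raises it to
    \<open>\<alpha> ^ (n + l)\<close>, matching the shifted exponent of
    \<open>V * C\<close>.\<close>
  have VCE: "V * (\<alpha> ^ n \<cdot>\<^sub>m (C * E))
    = mat n n (\<lambda>(i, l). (\<alpha> ^ (2 * i)) ^ (n + l) * \<alpha> ^ (n + l))"
  proof -
    have "V * (\<alpha> ^ n \<cdot>\<^sub>m (C * E)) = \<alpha> ^ n \<cdot>\<^sub>m (V * C * E)"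
      by (simp add: mult_smult_distrib[of _ n n _ n] assoc_mult_mat[of _ n n _ n _ n])
    also have "V * C * E = mat n n (\<lambda>(i, l). (\<alpha> ^ (2 * i)) ^ (n + l) * \<alpha> ^ l)"
      unfolding E_def by (subst mat_diag_mult_right[of _ n]) (auto simp: VC)
    finally show ?thesis by (auto simp: power_add)
  qed

  \<comment> \<open>In the right blocks the local column is \<open>l - n\<close>, so the exponent
    \<open>n + (l - n)\<close> is again \<open>l\<close> and a single formula covers left and
    right.\<close>
  have "block_diag2 V * F = mat N N (\<lambda>(i, l).
      if i < n then (\<alpha> ^ (2 * i)) ^ l else (\<alpha> ^ (2 * (i - n))) ^ l * \<alpha> ^ l)" (is "_ = ?M")
  proof -
    have "block_diag2 V * F
      = four_block_mat V (V * C) (V * E) (V * (\<alpha> ^ n \<cdot>\<^sub>m (C * E)))"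
      unfolding F_def by (subst block_diag2_mult_four_block_mat[of _ n n _ n _ n])
        (auto simp: right_mult_one_mat[OF V])
    also have "\<dots> = ?M"
      unfolding VC VE VCE by (rule eq_matI) (auto simp: V_def N)
    finally show ?thesis .
  qed
  \<comment> \<open>The last factor scales column \<open>l\<close> by \<open>\<alpha> ^ l\<close>,
    which multiplies every node by \<alpha>: odd powers of \<alpha> above, even ones below.\<close>
  then have VFD: "block_diag2 V * F * D = mat N N (\<lambda>(i, l).
      if i < n then \<alpha> ^ ((2 * i + 1) * l) else \<alpha> ^ ((2 * (i - n) + 2) * l))"
    unfolding D_def
    by (simp add: mat_diag_mult_right[of _ N])
      (rule eq_matI; auto simp: algebra_simps simp flip: power_mult power_add)

  have "P * block_diag2 A * block_diag2 D' * F * D = P * (block_diag2 A * block_diag2 D' * F * D)"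
    by (simp add: assoc_mult_mat[of _ N N _ N _ N] mult_carrier_mat[of _ N N _ N])
  also have "\<dots> = P * (block_diag2 V * F * D)"
    by (simp add: block_diag2_mult[of _ n n _ n] AD')
  \<comment> \<open>Row \<open>i\<close> needs the node \<open>\<alpha> ^ (i + 1)\<close>, so the
    odd powers in the upper half belong to the even rows, where the transposed permutation puts
    them.\<close>
  also have "\<dots> = delay_vandermonde N \<alpha>"
    unfolding VFD P_def
    by (subst transpose_even_odd_perm_mat_mult[of N _ N])
      (auto simp: N delay_vandermonde_def elim!: evenE oddE intro!: eq_matI)
  finally show ?thesis
    unfolding P_def A_def D'_def F_def C_def E_def D_def n_def by (rule sym)
qed

end
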